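(* Let $g\ge4$ be even. (1) Let $m\neq g-1$ be a primitive number, let $n=o_g(m)$, and let $x_0$ be a point of an extreme cycle $x_0,x_1,\dots,x_{n-1}$ for $\{0,m\}$ with digits $l_0,\dots,l_{n-1}\in\{0,m\}$, i.e. $x_{j+1}=(x_j+l_j)/g$ (indices modulo $n$). Put $k_i=l_i/m\in\{0,1\}$ and $d=\gcd\big(k_0+gk_1+\dots+g^{n-1}k_{n-1},\,g^n-1\big)$. Then $m=\frac{g^n-1}{d}$. (2) Conversely, let $n\ge1$ and let $k_0,\dots,k_{n-1}\in\{0,1\}$, not all zero; put $d=\gcd\big(k_0+gk_1+\dots+g^{n-1}k_{n-1},\,g^n-1\big)$ and $m=\frac{g^n-1}{d}$. Then $m$ is incomplete, and there is an extreme cycle for $\{0,m\}$ with digits $mk_0,mk_1,\dots,mk_{n-1}$, i.e. there are integers $x_0,\dots,x_{n-1}$, not all zero, with $x_{j+1}=(x_j+mk_j)/g$ for all $j$ (indices modulo $n$).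
   Context: For an odd integer $m\ge1$, an extreme cycle for the digit set $\{0,m\}$ (with respect to the even integer $g\ge4$) is a finite set of distinct integers $\{x_0,\dots,x_{r-1}\}$ together with digits $l_0,\dots,l_{r-1}\in\{0,m\}$ such that $x_{j+1}=(x_j+l_j)/g$ for $0\le j\le r-2$ and $x_0=(x_{r-1}+l_{r-1})/g$. The cycle $\{0\}$ is the trivial extreme cycle. $m$ is complete if the only extreme cycle for $\{0,m\}$ is the trivial one, and incomplete otherwise. An odd number $m$ is primitive if it is incomplete and every proper divisor of $m$ is complete. Primitive numbers are coprime to $g$, and $o_g(m)$ denotes the order of $g$ in $U(\mathbb{Z}_m)$; for a primitive $m$ every extreme cycle has exactly $o_g(m)$ elements. *)

theory Defs
  imports "HOL-Number_Theory.Number_Theory"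
begin

text \<open>The digits are natural numbers because they lie in \<open>{0, m}\<close> with \<open>m \<ge> 1\<close>.
  The equation is stated over the rationals, so that \<open>/\<close> is exact division.\<close>

definition cycle_relation :: "nat \<Rightarrow> nat \<Rightarrow> (nat \<Rightarrow> int) \<Rightarrow> (nat \<Rightarrow> nat) \<Rightarrow> bool" where
  "cycle_relation g r x l \<longleftrightarrow>
     (\<forall>j<r. rat_of_int (x (Suc j mod r)) = rat_of_int (x j + int (l j)) / rat_of_nat g)"

definition extreme_cycle_enum ::
    "nat \<Rightarrow> nat \<Rightarrow> nat \<Rightarrow> (nat \<Rightarrow> int) \<Rightarrow> (nat \<Rightarrow> nat) \<Rightarrow> bool" where
  "extreme_cycle_enum g m r x l \<longleftrightarrow>
     r \<ge> 1 \<and> inj_on x {..<r} \<and> (\<forall>j<r. l j \<in> {0, m}) \<and> cycle_relation g r x l"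

definition extreme_cycle :: "nat \<Rightarrow> nat \<Rightarrow> int set \<Rightarrow> bool" where
  "extreme_cycle g m C \<longleftrightarrow> (\<exists>r x l. extreme_cycle_enum g m r x l \<and> C = x ` {..<r})"

text \<open>Completeness and incompleteness are notions for odd \<open>m\<close> only, so both carry
  oddness (which also gives \<open>m \<ge> 1\<close>).\<close>

definition complete_number :: "nat \<Rightarrow> nat \<Rightarrow> bool" where
  "complete_number g m \<longleftrightarrow> odd m \<and> {C. extreme_cycle g m C} = {{0}}"

definition incomplete_number :: "nat \<Rightarrow> nat \<Rightarrow> bool" where
  "incomplete_number g m \<longleftrightarrow> odd m \<and> {C. extreme_cycle g m C} \<noteq> {{0}}"

definition primitive_number :: "nat \<Rightarrow> nat \<Rightarrow> bool" where
  "primitive_number g m \<longleftrightarrow>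
     incomplete_number g m \<and> (\<forall>d. d dvd m \<and> d \<noteq> m \<longrightarrow> complete_number g d)"

end

theory Submission imports Defs begin

text \<open>Multiplying the cycle equations by powers of \<open>g\<close> and adding them gives
  \<open>(g\<^sup>n - 1) x\<^sub>0 = m K\<close> with \<open>K = \<Sum> g\<^sup>i k\<^sub>i\<close>, so \<open>m' = (g\<^sup>n - 1) / gcd (K, g\<^sup>n - 1)\<close>
  divides \<open>m\<close>. Conversely the cyclic shifts of the digit expansion of \<open>K\<close>, divided by the
  gcd, solve the cycle equations for \<open>m'\<close>, so \<open>m'\<close> is incomplete, and primitivity of \<open>m\<close>
  forces \<open>m' = m\<close>.\<close>

section \<open>Integer form of the cycle equations and its telescoped sums\<close>

lemma cycle_relation_iff:
  assumes "g > 0"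
  shows "cycle_relation g r x l \<longleftrightarrow> (\<forall>j<r. int g * x (Suc j mod r) = x j + int (l j))"
proof -
  have "rat_of_int a = rat_of_int b / rat_of_nat g \<longleftrightarrow> int g * a = b" for a b
  proof -
    have "rat_of_int a = rat_of_int b / rat_of_nat g
        \<longleftrightarrow> rat_of_int (int g * a) = rat_of_int b"
      using assms by (auto simp: field_simps)
    then show ?thesis
      by (simp only: of_int_eq_iff)
  qed
  then show ?thesis
    unfolding cycle_relation_def by blast
qed

text \<open>Each step multiplies by \<open>g\<close> and adds one digit. The index
  \<open>j mod r\<close> admits \<open>j = r\<close>, where the left side returns to
  \<open>x 0\<close> and the closed form results; \<open>j = 1\<close> controls
  \<open>x 1\<close>.\<close>

lemma cycle_relation_telescope:
  assumes "g > 0" "cycle_relation g r x l" "j \<le> r"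
  shows "int g ^ j * x (j mod r) = x 0 + (\<Sum>i<j. int g ^ i * int (l i))"
  using assms(3)
proof (induction j)
  case (Suc j)
  then have "int g * x (Suc j mod r) = x j + int (l j)"
    using assms by (simp add: cycle_relation_iff)
  then have "int g ^ Suc j * x (Suc j mod r) = int g ^ j * (x j + int (l j))"
    by (simp only: power_Suc2 mult.assoc)
  with Suc show ?case
    by (simp add: algebra_simps)
qed simp

lemma cycle_relation_closed_form:
  assumes "g > 0" "cycle_relation g r x l"
  shows "(int g ^ r - 1) * x 0 = (\<Sum>i<r. int g ^ i * int (l i))"
  using cycle_relation_telescope[OF assms order_refl] by (simp add: algebra_simps)

section \<open>The trivial cycle and the size of cycle points\<close>

lemma extreme_cycle_zero: "extreme_cycle g m {0}"
  unfolding extreme_cycle_def extreme_cycle_enum_def cycle_relation_def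
  by (rule exI[of _ 1], rule exI[of _ "\<lambda>_. 0"], rule exI[of _ "\<lambda>_. 0"]) (auto simp: inj_on_def)

lemma incomplete_number_iff:
  "incomplete_number g m \<longleftrightarrow> odd m \<and> (\<exists>C. extreme_cycle g m C \<and> C \<noteq> {0})"
  unfolding incomplete_number_def using extreme_cycle_zero[of g m] by auto

text \<open>Every point \<open>a\<close> has a predecessor \<open>b\<close> in the cycle with
  \<open>b \<le> g * a \<le> b + m\<close>. The right inequality at the maximum and the left one at
  the minimum give the bounds.\<close>

lemma extreme_cycle_bounds:
  assumes "g > 1" "extreme_cycle g m C" "c \<in> C"
  shows "0 \<le> c" "(int g - 1) * c \<le> int m"
proof -
  obtain r x l where r: "r \<ge> 1" and l: "\<And>j. j < r \<Longrightarrow> l j \<in> {0, m}"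
    and rel: "cycle_relation g r x l" and C: "C = x ` {..<r}"
    using assms(2) unfolding extreme_cycle_def extreme_cycle_enum_def by blast
  have fin: "finite C" "C \<noteq> {}"
    using C assms(3) by auto
  have pred: "\<exists>b\<in>C. b \<le> int g * a \<and> int g * a \<le> b + int m" if a: "a \<in> C" for a
  proof -
    obtain i where i: "i < r" "a = x i"
      using a C by blast
    define j where "j = (if i = 0 then r - 1 else i - 1)"
    have j: "j < r" "Suc j mod r = i"
      using i r by (auto simp: j_def)
    then have "int g * a = x j + int (l j)"
      using rel assms(1) i by (auto simp: cycle_relation_iff)
    moreover have "x j \<in> C"
      using C j by auto
    ultimately show ?thesis
      using l[OF j(1)] by (intro bexI[of _ "x j"]) auto
  qed
  obtain b where "b \<in> C" "int g * Max C \<le> b + int m"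
    using pred[OF Max_in[OF fin]] by blast
  moreover from this have "b \<le> Max C"
    using fin by simp
  ultimately have "(int g - 1) * Max C \<le> int m"
    by (simp add: algebra_simps)
  moreover have "(int g - 1) * c \<le> (int g - 1) * Max C"
    using fin assms by (intro mult_left_mono) auto
  ultimately show "(int g - 1) * c \<le> int m"
    by linarith
  obtain b where "b \<in> C" "b \<le> int g * Min C"
    using pred[OF Min_in[OF fin]] by blast
  moreover from this have "Min C \<le> b"
    using fin by simp
  ultimately have "0 \<le> (int g - 1) * Min C"
    by (simp add: algebra_simps)
  then have "0 \<le> Min C"
    using assms(1) by (simp add: zero_le_mult_iff)
  also have "Min C \<le> c"
    using fin assms by simp
  finally show "0 \<le> c" .
qed

text \<open>For \<open>m < g - 1\<close> the bounds leave 0 as the only possible cycle point. This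
  serves to exclude order 1 for primitive \<open>m \<noteq> g - 1\<close>.\<close>

lemma incomplete_number_ge:
  assumes "g > 1" "incomplete_number g m"
  shows "g - 1 \<le> m"
proof (rule ccontr)
  assume "\<not> g - 1 \<le> m"
  then have less: "int m < int g - 1"
    by linarith
  obtain C where C: "extreme_cycle g m C" "C \<noteq> {0}"
    using assms(2) by (auto simp: incomplete_number_iff)
  have "c = 0" if "c \<in> C" for c
  proof -
    have "(int g - 1) * c < (int g - 1) * 1"
      using le_less_trans[OF extreme_cycle_bounds(2)[OF assms(1) C(1) that] less]
      by (simp only: mult_1_right)
    then have "c < 1"
      using less by (simp add: mult_less_cancel_left_pos)
    with extreme_cycle_bounds(1)[OF assms(1) C(1) that] show ?thesis
      by simp
  qed
  moreover have "C \<noteq> {}"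
    using C(1) unfolding extreme_cycle_def extreme_cycle_enum_def
    by (auto simp: lessThan_empty_iff)
  ultimately show False
    using C(2) by blast
qed

section \<open>From digit words to extreme cycles\<close>

text \<open>An extreme cycle needs distinct points, but a periodic digit word makes the orbit repeat
  within \<open>n\<close> steps. Cutting at the first return to \<open>x 0\<close> keeps the set of
  points and removes the repetitions.\<close>

lemma deterministic_periodic_enumeration:
  assumes step: "\<And>i j. x i = x j \<Longrightarrow> x (Suc i) = x (Suc j)"
    and n: "n \<ge> 1" "x n = x (0::nat)"
  obtains r where "1 \<le> r" "r \<le> n" "x r = x 0" "inj_on x {..<r}" "x ` {..<r} = x ` {..<n}"
proof -
  have shift: "x (i + t) = x (j + t)" if "x i = x j" for i j t
    using that by (induction t) (auto intro: step)
  define r where "r = (LEAST r. r \<ge> 1 \<and> x r = x 0)"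
  have r: "r \<ge> 1" "x r = x 0"
    using LeastI[of "\<lambda>r. r \<ge> 1 \<and> x r = x 0" n] n by (auto simp: r_def)
  have le: "r \<le> s" if "s \<ge> 1" "x s = x 0" for s
    using that by (auto simp: r_def intro: Least_le)
  have neq: "x i \<noteq> x j" if "i < j" "j < r" for i j
  proof
    assume "x i = x j"
    \<comment> \<open>Moving on by \<open>r - j\<close> steps turns \<open>x j\<close> into
      \<open>x r\<close>, so \<open>x 0\<close> would recur at the index \<open>i + (r - j)\<close>,
      which is below \<open>r\<close>.\<close>
    from shift[OF this, of "r - j"] have "x (i + (r - j)) = x 0"
      using that r by simp
    from le[OF _ this] that show False
      by arith
  qed
  have "x j = x (j mod r)" for j
  proof (induction j rule: less_induct)
    case (less j)
    show ?case
    proof (cases "j < r")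
      case False
      then have "x j = x (j - r)"
        using shift[OF r(2), of "j - r"] by simp
      with less[of "j - r"] False r show ?thesis
        by (simp add: le_mod_geq)
    qed simp
  qed
  then have "x ` {..<n} \<subseteq> x ` {..<r}"
    using r by (metis image_subsetI imageI lessThan_iff less_le_trans mod_less_divisor zero_less_one)
  moreover have "r \<le> n"
    using le n by blast
  ultimately show thesis
    using r neq by (intro that[of r]) (auto simp: inj_on_def, metis linorder_neqE_nat)
qed

text \<open>In base \<open>g\<close>, multiplication by \<open>g\<close> raises every digit by one
  place. Compared with the previous shift, only the digit \<open>k (j mod n)\<close> differs: it
  stands at place \<open>n\<close> instead of place 0, an excess of \<open>g ^ n - 1\<close> times
  that digit.\<close>

lemma cyclic_shift_sum:
  fixes g :: nat and k :: "nat \<Rightarrow> nat"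
  assumes "n \<ge> 1" "g > 0"
  shows "g * (\<Sum>i<n. g ^ i * k ((i + Suc j) mod n))
       = (\<Sum>i<n. g ^ i * k ((i + j) mod n)) + (g ^ n - 1) * k (j mod n)"
proof -
  define f where "f i = g ^ i * k ((i + j) mod n)" for i
  have "g * (\<Sum>i<n. g ^ i * k ((i + Suc j) mod n)) = (\<Sum>i<n. f (Suc i))"
    by (simp add: f_def sum_distrib_left mult.assoc)
  then have "f 0 + g * (\<Sum>i<n. g ^ i * k ((i + Suc j) mod n)) = (\<Sum>i<n. f i) + f n"
    using sum.lessThan_Suc_shift[of f n] by simp
  moreover have "f n = f 0 + (g ^ n - 1) * k (j mod n)"
    using assms by (simp add: f_def diff_mult_distrib)
  ultimately show ?thesis
    by (simp add: f_def)
qed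

lemma exists_extreme_cycle_of_digits:
  fixes g n :: nat and k :: "nat \<Rightarrow> nat"
  assumes g: "even g" "g \<ge> 4" and n: "n \<ge> 1"
    and k: "\<forall>i<n. k i \<in> {0, 1}" "\<exists>i<n. k i \<noteq> 0"
    and d: "d = gcd (\<Sum>i<n. g ^ i * k i) (g ^ n - 1)"
    and m: "m = (g ^ n - 1) div d"
  shows "incomplete_number g m \<and>
    (\<exists>x::nat \<Rightarrow> int. extreme_cycle g m (x ` {..<n}) \<and> (\<exists>j<n. x j \<noteq> 0) \<and>
       cycle_relation g n x (\<lambda>j. m * k j))"
proof -
  define S where "S j = (\<Sum>i<n. g ^ i * k ((i + j) mod n))" for j
  have g0: "g > 0" using g by simp
  have S_step: "g * S (Suc j) = S j + (g ^ n - 1) * k (j mod n)" for j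
    unfolding S_def by (rule cyclic_shift_sum[OF n g0])
  have md: "m * d = g ^ n - 1"
    using m d by simp
  have "g ^ n \<ge> g ^ 1"
    using n g0 by (intro power_increasing) auto
  then have gn: "g ^ n > 1"
    using g by simp
  have d0: "d > 0"
    using md gn by (intro gr0I) auto
  \<comment> \<open>Both factors of \<open>m * d = g ^ n - 1\<close> inherit coprimality to
    \<open>g\<close>. For \<open>m\<close> this yields oddness, as \<open>g\<close> is even; for
    \<open>d\<close> it permits cancelling \<open>g\<close>.\<close>
  have "coprime (g ^ n - 1) g"
  proof -
    have "coprime (g ^ n) (g ^ n - 1)"
      using coprime_diff_one_right_nat[of "g ^ n"] gn by linarith
    then show ?thesis
      using n by (simp add: coprime_commute)
  qed
  then have cop: "coprime m g" "coprime d g"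
    unfolding md[symmetric] by simp_all
  have odd_m: "odd m"
    using cop(1) g(1) by (metis coprime_common_divisor odd_one)
  have dvd_S: "d dvd S j" for j
  proof (induction j)
    case 0
    show ?case by (simp add: S_def d)
  next
    case (Suc j)
    \<comment> \<open>Both terms on the right of \<open>S_step\<close> are multiples of
      \<open>d\<close>.\<close>
    have "d dvd g * S (Suc j)"
      using Suc unfolding S_step md[symmetric] by simp
    then show ?case
      using cop(2) by (simp add: coprime_dvd_mult_right_iff)
  qed
  define q where "q j = S j div d" for j
  define x where "x j = int (q j)" for j
  have S_eq: "S j = d * q j" for j
    using dvd_S by (simp add: q_def)
  have x_step: "int g * x (Suc j) = x j + int (m * k (j mod n))" for j
  proof -
    have "d * (g * q (Suc j)) = d * (q j + m * k (j mod n))"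
      using S_step[of j, folded md] unfolding S_eq by (simp add: algebra_simps)
    then have "g * q (Suc j) = q j + m * k (j mod n)"
      using d0 by simp
    then show ?thesis
      unfolding x_def by (metis of_nat_add of_nat_mult)
  qed
  have k01: "k (j mod n) \<in> {0, 1}" for j
    using k(1) n by simp
  have not_dvd: "\<not> int g dvd int m"
    using cop(1) g coprime_absorb_right[of g m] by auto
  \<comment> \<open>As \<open>g\<close> does not divide \<open>m\<close>, the residue of \<open>x j\<close> modulo \<open>g\<close> determines the digit.\<close>
  have x_det: "x (Suc i) = x (Suc j)" if "x i = x j" for i j
  proof -
    have eq: "int g * (x (Suc i) - x (Suc j)) = int m * (int (k (i mod n)) - int (k (j mod n)))"
      using x_step[of i] x_step[of j] that by (simp add: algebra_simps)
    have "k (i mod n) = k (j mod n)"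
    proof (rule ccontr)
      assume "k (i mod n) \<noteq> k (j mod n)"
      then have "int g * (x (Suc i) - x (Suc j)) = int m
               \<or> int g * (x (Suc i) - x (Suc j)) = - int m"
        using eq k01[of i] k01[of j] by auto
      then show False
        using not_dvd by (metis dvd_minus_iff dvd_triv_left)
    qed
    with eq g0 show ?thesis by simp
  qed
  have x_mod: "x (j mod n) = x j" for j
    by (simp add: x_def q_def S_def mod_add_right_eq)
  have x_n: "x n = x 0"
    using x_mod[of n] by simp
  obtain r where r: "1 \<le> r" "r \<le> n" "x r = x 0" "inj_on x {..<r}" "x ` {..<r} = x ` {..<n}"
    using deterministic_periodic_enumeration[of x n, OF x_det n x_n] by blast
  \<comment> \<open>The first \<open>r\<close> digits suffice: the orbit closes after
    \<open>r\<close> steps, as \<open>x r = x 0\<close>.\<close>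
  have "extreme_cycle_enum g m r x (\<lambda>j. m * k j)"
    unfolding extreme_cycle_enum_def
  proof (intro conjI r)
    show "\<forall>j<r. m * k j \<in> {0, m}"
    proof (intro allI impI)
      fix j assume "j < r"
      then have "k j \<in> {0, 1}"
        using k(1) r(2) by simp
      then show "m * k j \<in> {0, m}"
        by auto
    qed
    have "int g * x (Suc j mod r) = x j + int (m * k j)" if "j < r" for j
    proof -
      have "x (Suc j mod r) = x (Suc j)"
        using that r(3) by (cases "Suc j = r") auto
      then show ?thesis
        using x_step[of j] that r(2) by simp
    qed
    then show "cycle_relation g r x (\<lambda>j. m * k j)"
      using g0 by (simp add: cycle_relation_iff)
  qed
  then have cycle: "extreme_cycle g m (x ` {..<n})"
    unfolding extreme_cycle_def using r(5) by metis
  have rel: "cycle_relation g n x (\<lambda>j. m * k j)"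
    using x_step g0 by (simp add: cycle_relation_iff x_mod del: of_nat_mult)
  have "S 0 \<noteq> 0"
    using k(2) g0 by (auto simp: S_def)
  then have "x 0 \<noteq> 0"
    using S_eq[of 0] by (auto simp: x_def)
  with n have nz: "\<exists>j<n. x j \<noteq> 0"
    by (intro exI[of _ 0]) auto
  then have "x ` {..<n} \<noteq> {0}"
    by auto
  with cycle odd_m have "incomplete_number g m"
    by (auto simp: incomplete_number_iff)
  with cycle rel nz show ?thesis by blast
qed

section \<open>Primitive numbers and the final statement\<close>

lemma primitive_number_eq:
  fixes g m n :: nat and x :: "nat \<Rightarrow> int" and k l :: "nat \<Rightarrow> nat"
  assumes g: "even g" "g \<ge> 4" and prim: "primitive_number g m" and ne: "m \<noteq> g - 1"
    and n: "n = ord m g" and enum: "extreme_cycle_enum g m n x l"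
    and k: "\<forall>i<n. k i = l i div m"
    and d: "d = gcd (\<Sum>i<n. g ^ i * k i) (g ^ n - 1)"
  shows "m = (g ^ n - 1) div d"
proof -
  have g0: "g > 0" using g by simp
  have inc: "incomplete_number g m"
    using prim by (simp add: primitive_number_def)
  then have m0: "m > 0"
    by (auto simp: incomplete_number_def intro: odd_pos)
  have n1: "n \<ge> 1" and inj: "inj_on x {..<n}" and rel: "cycle_relation g n x l"
    and l: "\<And>i. i < n \<Longrightarrow> l i = m * k i" and k01: "\<forall>i<n. k i \<in> {0, 1}"
    using enum k m0 by (auto simp: extreme_cycle_enum_def)
  \<comment> \<open>A one-point enumeration could be the trivial cycle. Order 1 means that
    \<open>m\<close> divides \<open>g - 1\<close>, and incompleteness then forces
    \<open>m = g - 1\<close>.\<close>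
  have "n \<noteq> 1"
  proof
    assume "n = 1"
    then have "[g = 1] (mod m)"
      using ord[of g m] n by simp
    then have "m dvd g - 1"
      by (rule cong_to_1_nat)
    then have "m \<le> g - 1"
      using g by (intro dvd_imp_le) auto
    with incomplete_number_ge[OF _ inc] ne g show False
      by simp
  qed
  with n1 have n2: "n \<ge> 2" by simp
  \<comment> \<open>Zero digits throughout would give \<open>x 0 = x 1 = 0\<close>, against
    distinctness of the points.\<close>
  have nz: "\<exists>i<n. k i \<noteq> 0"
  proof (rule ccontr)
    assume "\<not> ?thesis"
    then have l0: "\<And>i. i < n \<Longrightarrow> l i = 0"
      using l by simp
    have "int g ^ n > 1"
      using g n1 by (intro one_less_power) auto
    have "x 0 = 0"
      using cycle_relation_closed_form[OF g0 rel] l0 \<open>int g ^ n > 1\<close> by simp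
    moreover from this have "x 1 = 0"
      using cycle_relation_telescope[OF g0 rel, of 1] l0 n2 g0 by simp
    ultimately show False
      using inj_onD[OF inj, of 0 1] n2 by simp
  qed
  define K where "K = (\<Sum>i<n. g ^ i * k i)"
  define m' where "m' = (g ^ n - 1) div d"
  have inc': "incomplete_number g m'"
    using exists_extreme_cycle_of_digits[OF g n1 k01 nz d m'_def] by blast
  have "(\<Sum>i<n. int g ^ i * int (l i)) = int (m * K)"
    using l by (simp add: K_def sum_distrib_left algebra_simps)
  then have "int (g ^ n - 1) * x 0 = int (m * K)"
    using cycle_relation_closed_form[OF g0 rel] g0 by (simp add: of_nat_diff)
  then have dvd: "g ^ n - 1 dvd m * K"
    by (metis dvd_triv_left int_dvd_int_iff)
  have "K \<noteq> 0"
    using nz g0 by (auto simp: K_def)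
  then have d0: "d \<noteq> 0" and dK: "d dvd K" and dg: "d dvd g ^ n - 1"
    by (auto simp: d K_def)
  have "coprime m' (K div d)"
    using \<open>K \<noteq> 0\<close> unfolding m'_def d K_def[symmetric]
    by (subst coprime_commute, intro div_gcd_coprime) simp
  moreover have "m' dvd m * (K div d)"
  proof -
    have "d * m' dvd d * (m * (K div d))"
      using dvd dvd_mult_div_cancel[OF dK] dvd_mult_div_cancel[OF dg]
      unfolding m'_def by (metis mult.left_commute)
    then show ?thesis using d0 by simp
  qed
  ultimately have "m' dvd m"
    by (simp add: coprime_dvd_mult_left_iff)
  with prim inc' have "m' = m"
    unfolding primitive_number_def complete_number_def incomplete_number_def by blast
  then show ?thesis by (simp add: m'_def)
qed

theorem theorem4p9:
  fixes g :: nat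
  assumes "even g" and "g \<ge> 4"
  shows
    "(\<forall>(m::nat) (n::nat) (x::nat \<Rightarrow> int) (l::nat \<Rightarrow> nat) (k::nat \<Rightarrow> nat) (d::nat).
        primitive_number g m \<and> m \<noteq> g - 1 \<and> n = ord m g \<and>
        extreme_cycle_enum g m n x l \<and>
        (\<forall>i<n. k i = l i div m) \<and>
        d = gcd (\<Sum>i<n. g ^ i * k i) (g ^ n - 1) \<longrightarrow>
        m = (g ^ n - 1) div d)
     \<and>
     (\<forall>(n::nat) (k::nat \<Rightarrow> nat) (d::nat) (m::nat).
        n \<ge> 1 \<and> (\<forall>i<n. k i \<in> {0, 1}) \<and> (\<exists>i<n. k i \<noteq> 0) \<and>
        d = gcd (\<Sum>i<n. g ^ i * k i) (g ^ n - 1) \<and>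
        m = (g ^ n - 1) div d \<longrightarrow>
        incomplete_number g m \<and>
        (\<exists>x::nat \<Rightarrow> int.
           extreme_cycle g m (x ` {..<n}) \<and> (\<exists>j<n. x j \<noteq> 0) \<and>
           cycle_relation g n x (\<lambda>j. m * k j)))"
  using primitive_number_eq[OF assms] exists_extreme_cycle_of_digits[OF assms]
  by (intro conjI allI impI; elim conjE) blast+

end
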